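(* Let $\delta x>0$ and let $\rho_i\in[0,R)$, $i\in\mathbb{Z}$, be a sequence with $\sup_{i\in\mathbb{Z}}\rho_i<R$ and $\sum_{i\in\mathbb{Z}}\rho_i<+\infty$. For $\delta t\ge0$ let $$\rho_i^+=\rho_i+\frac{\delta t}{\delta x}(G_{i-1}-G_i),\qquad G_i=\rho_i h(-q_i),\qquad q_i=\frac{Q'(\rho_{i+1})-Q'(\rho_i)}{\delta x},\qquad i\in\mathbb{Z},$$ and define $f(\delta t)=\delta x\sum_{i\in\mathbb{Z}}Q(\rho_i^+)$ for all $\delta t\ge0$ for which $\rho_i^+\in[0,R)$ for all $i\in\mathbb{Z}$. Then the (right) derivative of $f$ at $0$ satisfies $$\frac{df}{d\,\delta t}(0)=\delta x\sum_{i\in\mathbb{Z}}\rho_i q_i h(-q_i)\le 0.$$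
   Context: Constants: $R>1$, $b>0$. The function $\kappa\in C^1([0,R);[0,+\infty))$ satisfies $\kappa(\rho)=0$ for $\rho\in[0,1]$ and $\kappa(\rho)>0$ for $\rho\in(1,R)$. The function $h\in C^1(\mathbb{R};(-1,b))$ satisfies $h'\in L^\infty(\mathbb{R})$, $h(0)=0$, $h'(s)>0$ for all $s\in\mathbb{R}$, and is onto $(-1,b)$. Define $Q(\rho)=\int_1^\rho(\rho-\tau)\kappa(\tau)\,d\tau$ for $\rho\in[0,R)$, so $Q'(\rho)=\int_1^\rho\kappa(\tau)\,d\tau$. *)

theory Defs
  imports "HOL-Analysis.Analysis"
begin

text \<open>Continuous differentiability with derivatives taken within the set, so one-sided at an endpoint
  that belongs to it. The library's \<^const>\<open>C1_differentiable_on\<close> uses two-sided derivatives and would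
  therefore constrain a function on \<open>[0,R)\<close> to the left of \<open>0\<close> as well.\<close>

definition C1_within :: "real set \<Rightarrow> (real \<Rightarrow> real) \<Rightarrow> bool" where
  "C1_within S f \<longleftrightarrow>
     (\<exists>f'. (\<forall>x\<in>S. (f has_real_derivative f' x) (at x within S)) \<and> continuous_on S f')"

definition Linfty :: "(real \<Rightarrow> real) \<Rightarrow> bool" where
  "Linfty g \<longleftrightarrow> g \<in> borel_measurable lborel \<and> (\<exists>C. AE x in lborel. \<bar>g x\<bar> \<le> C)"

text \<open>The integral is oriented, so the formula is meaningful for \<open>\<rho> < 1\<close> too.\<close>

definition Q :: "(real \<Rightarrow> real) \<Rightarrow> real \<Rightarrow> real" where
  "Q \<kappa> \<rho> = (LBINT \<tau>=1..\<rho>. (\<rho> - \<tau>) * \<kappa> \<tau>)"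

text \<open>The derivative of \<open>Q\<close> as a function on \<open>[0,R)\<close>, hence one-sided at \<open>0\<close>.\<close>

definition Q' :: "real \<Rightarrow> (real \<Rightarrow> real) \<Rightarrow> real \<Rightarrow> real" where
  "Q' R \<kappa> \<rho> = vector_derivative (Q \<kappa>) (at \<rho> within {0..<R})"

definition q :: "real \<Rightarrow> (real \<Rightarrow> real) \<Rightarrow> real \<Rightarrow> (int \<Rightarrow> real) \<Rightarrow> int \<Rightarrow> real" where
  "q R \<kappa> \<delta>x \<rho> i = (Q' R \<kappa> (\<rho> (i + 1)) - Q' R \<kappa> (\<rho> i)) / \<delta>x"

definition G ::
  "real \<Rightarrow> (real \<Rightarrow> real) \<Rightarrow> (real \<Rightarrow> real) \<Rightarrow> real \<Rightarrow> (int \<Rightarrow> real) \<Rightarrow> int \<Rightarrow> real" where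
  "G R \<kappa> h \<delta>x \<rho> i = \<rho> i * h (- q R \<kappa> \<delta>x \<rho> i)"

definition rho_plus ::
  "real \<Rightarrow> (real \<Rightarrow> real) \<Rightarrow> (real \<Rightarrow> real) \<Rightarrow> real \<Rightarrow> (int \<Rightarrow> real) \<Rightarrow> real \<Rightarrow> int \<Rightarrow> real" where
  "rho_plus R \<kappa> h \<delta>x \<rho> \<delta>t i =
     \<rho> i + \<delta>t / \<delta>x * (G R \<kappa> h \<delta>x \<rho> (i - 1) - G R \<kappa> h \<delta>x \<rho> i)"

definition admissible_steps ::
  "real \<Rightarrow> (real \<Rightarrow> real) \<Rightarrow> (real \<Rightarrow> real) \<Rightarrow> real \<Rightarrow> (int \<Rightarrow> real) \<Rightarrow> real set" where
  "admissible_steps R \<kappa> h \<delta>x \<rho> =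
     {\<delta>t. 0 \<le> \<delta>t \<and> (\<forall>i. rho_plus R \<kappa> h \<delta>x \<rho> \<delta>t i \<in> {0..<R})}"

text \<open>Meaningful only for \<open>\<delta>t\<close> in \<^const>\<open>admissible_steps\<close>.\<close>

definition discrete_energy ::
  "real \<Rightarrow> (real \<Rightarrow> real) \<Rightarrow> (real \<Rightarrow> real) \<Rightarrow> real \<Rightarrow> (int \<Rightarrow> real) \<Rightarrow> real \<Rightarrow> real" where
  "discrete_energy R \<kappa> h \<delta>x \<rho> \<delta>t = \<delta>x * (\<Sum>\<^sub>\<infinity>i\<in>UNIV. Q \<kappa> (rho_plus R \<kappa> h \<delta>x \<rho> \<delta>t i))"

lemma Q_has_derivative:
  assumes "1 < R" "continuous_on {0..<R} \<kappa>" "\<rho> \<in> {0..<R}"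
  shows "(Q \<kappa> has_real_derivative (LBINT \<tau>=1..\<rho>. \<kappa> \<tau>)) (at \<rho> within {0..<R})"
proof -
  define b where "b = (max 1 \<rho> + R) / 2"
  have b: "1 < b" "\<rho> < b" "b < R" "0 \<le> \<rho>"
    using assms by (auto simp: b_def max_def)
  have ck: "continuous_on {0..b} \<kappa>"
    by (rule continuous_on_subset[OF assms(2)]) (use b in auto)
  have ct: "continuous_on {0..b} (\<lambda>\<tau>. \<tau> * \<kappa> \<tau>)"
    by (intro continuous_intros ck)
  have int: "interval_lebesgue_integrable lborel (ereal 1) (ereal u) g"
    if u: "u \<in> {0..b}" and g: "continuous_on {0..b} g" for u :: real and g :: "real \<Rightarrow> real"
  proof (cases "1 \<le> u")
    case True
    then show ?thesis
      by (intro interval_integrable_continuous_on continuous_on_subset[OF g]) (use u b in auto)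
  next
    case False
    then have "interval_lebesgue_integrable lborel (ereal u) (ereal 1) g"
      by (intro interval_integrable_continuous_on continuous_on_subset[OF g]) (use u b in auto)
    then show ?thesis
      using interval_integrable_endpoints_reverse by blast
  qed
  have split: "Q \<kappa> u = u * (LBINT \<tau>=ereal 1..u. \<kappa> \<tau>) - (LBINT \<tau>=ereal 1..u. \<tau> * \<kappa> \<tau>)"
    if "u \<in> {0..b}" for u
  proof -
    have "Q \<kappa> u = (LBINT \<tau>=ereal 1..u. u * \<kappa> \<tau> - \<tau> * \<kappa> \<tau>)"
      by (simp add: Q_def algebra_simps one_ereal_def)
    also have "\<dots> = (LBINT \<tau>=ereal 1..u. u * \<kappa> \<tau>) - (LBINT \<tau>=ereal 1..u. \<tau> * \<kappa> \<tau>)"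
      by (intro interval_lebesgue_integral_diff int that continuous_intros ck)
    finally show ?thesis
      by simp
  qed
  have d: "((\<lambda>u. LBINT \<tau>=ereal 1..ereal u. g \<tau>) has_real_derivative g \<rho>) (at \<rho> within {0..b})"
    if "continuous_on {0..b} g" for g
    unfolding has_real_derivative_iff_has_vector_derivative
    by (rule interval_integral_FTC2) (use b that in auto)
  have "((\<lambda>u. u * (LBINT \<tau>=ereal 1..u. \<kappa> \<tau>) - (LBINT \<tau>=ereal 1..u. \<tau> * \<kappa> \<tau>))
      has_real_derivative (LBINT \<tau>=ereal 1..\<rho>. \<kappa> \<tau>)) (at \<rho> within {0..b})"
    by (rule derivative_eq_intros d ck ct refl)+ (simp add: algebra_simps)
  then have "(Q \<kappa> has_real_derivative (LBINT \<tau>=ereal 1..\<rho>. \<kappa> \<tau>)) (at \<rho> within {0..b})"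
    by (rule has_field_derivative_transform_within[where d=1]) (use b split in auto)
  moreover have "at \<rho> within {0..b} = at \<rho> within {0..<R}"
    by (rule at_within_nhd[of _ "{..<b}"]) (use b in auto)
  ultimately show ?thesis
    by (simp add: one_ereal_def)
qed

lemma Q'_eq:
  assumes "1 < R" "continuous_on {0..<R} \<kappa>" "\<rho> \<in> {0..<R}"
  shows "Q' R \<kappa> \<rho> = (LBINT \<tau>=1..\<rho>. \<kappa> \<tau>)"
proof -
  have "at \<rho> within {\<rho><..<R} \<noteq> bot"
    using assms by (simp add: at_within_eq_bot_iff)
  then have "at \<rho> within {0..<R} \<noteq> bot"
    using at_le[of "{\<rho><..<R}" "{0..<R}" \<rho>] assms
    by (metis atLeastLessThan_iff bot_unique greaterThanLessThan_iff less_imp_le order_trans subsetI)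
  then show ?thesis
    unfolding Q'_def using Q_has_derivative[OF assms]
    by (intro vector_derivative_within)
      (simp_all add: has_real_derivative_iff_has_vector_derivative)
qed

end

theory Submission
  imports Defs
begin

text \<open>The potential \<open>Q\<close> vanishes on \<open>[0,1]\<close>, while a summable density exceeds \<open>1\<close> at finitely many
  sites only. The summability of \<open>\<rho>\<close> and of the fluxes makes this uniform for small time steps: there
  is one finite set of sites outside of which \<open>\<rho> + \<delta>t d\<close>, with \<open>d\<close> the discrete divergence of the flux,
  stays below \<open>1\<close> (lemma \<open>infsum_has_derivative_of_dead_zone\<close>). The energy is then a finite sum, which
  may be differentiated termwise by the chain rule and gives \<open>\<Sum> Q'(\<rho>\<^sub>i) d\<^sub>i\<close>. Summation by parts, in
  which no boundary terms arise because \<open>Q'(\<rho>\<^sub>i)\<close> has finite support, turns this into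
  \<open>\<Sum> \<rho>\<^sub>i q\<^sub>i h(-q\<^sub>i)\<close>, and every term is nonpositive because \<open>h\<close> is increasing and vanishes at \<open>0\<close>.

  The delicate point is that small time steps are admissible at all, as nonnegativity could fail at
  sites where \<open>\<rho>\<^sub>i\<close> is close to \<open>0\<close> compared with \<open>\<rho>\<close> at site \<open>i - 1\<close>. A site with \<open>\<rho>\<^sub>i \<le> 1\<close> has
  \<open>Q'(\<rho>\<^sub>i) = 0\<close>, the minimum of \<open>Q'\<close>, so the flux from site \<open>i - 1\<close> can only bring mass in, and
  what leaves is at most proportional to \<open>\<rho>\<^sub>i\<close> itself. A site with \<open>\<rho>\<^sub>i > 1\<close> has room for any small
  perturbation (lemma \<open>rho_plus_in_range\<close>).\<close>

section \<open>Sums with finitely many active terms\<close>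

lemma summable_on_diff:
  fixes f g :: "'a \<Rightarrow> real"
  assumes "f summable_on A" "g summable_on A"
  shows "(\<lambda>x. f x - g x) summable_on A"
  using summable_on_add[OF assms(1) summable_on_uminus[THEN iffD2, OF assms(2)]] by simp

lemma infsum_diff:
  fixes f g :: "'a \<Rightarrow> real"
  assumes "f summable_on A" "g summable_on A"
  shows "(\<Sum>\<^sub>\<infinity>x\<in>A. f x - g x) = infsum f A - infsum g A"
  using infsum_add[OF assms(1) summable_on_uminus[THEN iffD2, OF assms(2)]]
  by (simp add: infsum_uminus)

lemma finite_superlevel_set_of_summable:
  fixes f :: "'a \<Rightarrow> real"
  assumes "f summable_on UNIV" "\<And>x. 0 \<le> f x" "0 < c"
  shows "finite {x. c < f x}"
proof (rule ccontr)
  assume "infinite {x. c < f x}"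
  obtain n :: nat where n: "infsum f UNIV < real n * c"
    using reals_Archimedean3[OF assms(3)] by blast
  obtain F where F: "finite F" "card F = n" "F \<subseteq> {x. c < f x}"
    using infinite_arbitrarily_large[OF \<open>infinite {x. c < f x}\<close>] by blast
  have "real n * c \<le> sum f F"
    using sum_bounded_below[of F c f] F by fastforce
  also have "\<dots> \<le> infsum f UNIV"
    by (rule finite_sum_le_infsum) (use assms F in auto)
  finally show False
    using n by simp
qed

text \<open>The finite support of \<open>u\<close> cuts off both ends of the sum, so \<open>g\<close> can be arbitrary and no boundary
  terms arise.\<close>

lemma summation_by_parts_finite_support:
  fixes u g :: "int \<Rightarrow> real"
  assumes fin: "finite {i. u i \<noteq> 0}"
  shows "(\<lambda>i. g i * (u (i + 1) - u i)) summable_on UNIV"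
    and "(\<Sum>\<^sub>\<infinity>i. u i * (g (i - 1) - g i)) = (\<Sum>\<^sub>\<infinity>i. g i * (u (i + 1) - u i))"
proof -
  have s: "(\<lambda>i. u i * v i) summable_on UNIV" for v
    by (rule finite_nonzero_values_imp_summable_on, rule finite_subset[OF _ fin]) auto
  have bij: "bij_betw (\<lambda>i::int. i + 1) UNIV UNIV"
    by (rule bij_betw_byWitness[where f' = "\<lambda>i. i - 1"]) auto
  have s1: "(\<lambda>i. u (i + 1) * g i) summable_on UNIV"
    using summable_on_reindex_bij_betw[OF bij, of "\<lambda>i. u i * g (i - 1)"] s by simp
  have i1: "(\<Sum>\<^sub>\<infinity>i. u (i + 1) * g i) = (\<Sum>\<^sub>\<infinity>i. u i * g (i - 1))"
    using infsum_reindex_bij_betw[OF bij, of "\<lambda>i. u i * g (i - 1)"] by simp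
  have eq: "(\<lambda>i. g i * (u (i + 1) - u i)) = (\<lambda>i. u (i + 1) * g i - u i * g i)"
    by (auto simp: algebra_simps)
  show "(\<lambda>i. g i * (u (i + 1) - u i)) summable_on UNIV"
    unfolding eq by (rule summable_on_diff[OF s1 s])
  show "(\<Sum>\<^sub>\<infinity>i. u i * (g (i - 1) - g i)) = (\<Sum>\<^sub>\<infinity>i. g i * (u (i + 1) - u i))"
    unfolding eq infsum_diff[OF s1 s] i1 using infsum_diff[OF s s] by (simp add: right_diff_distrib)
qed

text \<open>Termwise differentiation needs no uniform control of the tail, because the tail vanishes
  identically: as \<open>\<rho> + \<epsilon> \<bar>d\<bar>\<close> is summable, it exceeds \<open>1\<close> on a finite set only, and this set serves
  all steps in \<open>[0,\<epsilon>]\<close>.\<close>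

lemma infsum_has_derivative_of_dead_zone:
  fixes E E' :: "real \<Rightarrow> real" and \<rho> d :: "'i \<Rightarrow> real"
  assumes \<rho>: "\<rho> summable_on UNIV" "\<And>i. 0 \<le> \<rho> i" and d: "d summable_on UNIV"
    and "0 < \<epsilon>" and range: "\<And>t i. t \<in> {0..\<epsilon>} \<Longrightarrow> \<rho> i + t * d i \<in> {0..<R}"
    and E: "\<And>r. r \<in> {0..<R} \<Longrightarrow> (E has_real_derivative E' r) (at r within {0..<R})"
    and dead: "\<And>r. r \<in> {0..1} \<Longrightarrow> E r = 0" "\<And>r. r \<in> {0..1} \<Longrightarrow> E' r = 0"
  shows "((\<lambda>t. \<Sum>\<^sub>\<infinity>i. E (\<rho> i + t * d i)) has_real_derivative (\<Sum>\<^sub>\<infinity>i. E' (\<rho> i) * d i)) (at_right 0)"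
proof -
  define F where "F = {i. 1 < \<rho> i + \<epsilon> * \<bar>d i\<bar>}"
  have "(\<lambda>i. \<bar>d i\<bar>) summable_on UNIV"
    using summable_on_iff_abs_summable_on_real[THEN iffD1, OF d] by simp
  then have "(\<lambda>i. \<rho> i + \<epsilon> * \<bar>d i\<bar>) summable_on UNIV"
    by (intro summable_on_add \<rho> summable_on_cmult_right)
  then have fin: "finite F"
    unfolding F_def by (rule finite_superlevel_set_of_summable) (use \<rho> \<open>0 < \<epsilon>\<close> in auto)
  have low: "\<rho> i + t * d i \<in> {0..1}" if "t \<in> {0..\<epsilon>}" "i \<notin> F" for t i
  proof -
    have "t * d i \<le> t * \<bar>d i\<bar>"
      using that by (intro mult_left_mono) auto
    also have "\<dots> \<le> \<epsilon> * \<bar>d i\<bar>"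
      using that by (intro mult_right_mono) auto
    finally show ?thesis
      using that range[of t i] by (auto simp: F_def)
  qed
  have energy: "(\<Sum>\<^sub>\<infinity>i. E (\<rho> i + t * d i)) = (\<Sum>i\<in>F. E (\<rho> i + t * d i))" if "t \<in> {0..\<epsilon>}" for t
    using infsum_cong_neutral[of F UNIV "\<lambda>i. E (\<rho> i + t * d i)" "\<lambda>i. E (\<rho> i + t * d i)"]
      low[OF that] dead fin by auto
  have slope: "(\<Sum>\<^sub>\<infinity>i. E' (\<rho> i) * d i) = (\<Sum>i\<in>F. E' (\<rho> i) * d i)"
    using infsum_cong_neutral[of F UNIV "\<lambda>i. E' (\<rho> i) * d i" "\<lambda>i. E' (\<rho> i) * d i"]
      low[of 0] dead fin \<open>0 < \<epsilon>\<close> by auto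
  have "((\<lambda>t. E (\<rho> i + t * d i)) has_real_derivative E' (\<rho> i) * d i) (at 0 within {0..\<epsilon>})" for i
  proof -
    have "(E has_real_derivative E' (\<rho> i)) (at (\<rho> i) within (\<lambda>t. \<rho> i + t * d i) ` {0..\<epsilon>})"
      by (rule DERIV_subset[OF E]) (use range[of 0 i] range \<open>0 < \<epsilon>\<close> in auto)
    moreover have "((\<lambda>t. \<rho> i + t * d i) has_real_derivative d i) (at 0 within {0..\<epsilon>})"
      by (auto intro!: derivative_eq_intros)
    ultimately show ?thesis
      using DERIV_image_chain[of E "E' (\<rho> i)" "\<lambda>t. \<rho> i + t * d i" 0 "{0..\<epsilon>}" "d i"]
      by (simp add: o_def)
  qed
  then have "((\<lambda>t. \<Sum>i\<in>F. E (\<rho> i + t * d i)) has_real_derivative (\<Sum>i\<in>F. E' (\<rho> i) * d i))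
      (at 0 within {0..\<epsilon>})"
    by (rule DERIV_sum)
  then have "((\<lambda>t. \<Sum>\<^sub>\<infinity>i. E (\<rho> i + t * d i)) has_real_derivative (\<Sum>\<^sub>\<infinity>i. E' (\<rho> i) * d i))
      (at 0 within {0..\<epsilon>})"
    unfolding slope
    by (rule has_field_derivative_transform_within[where d = 1]) (use energy \<open>0 < \<epsilon>\<close> in auto)
  then have "((\<lambda>t. \<Sum>\<^sub>\<infinity>i. E (\<rho> i + t * d i)) has_real_derivative (\<Sum>\<^sub>\<infinity>i. E' (\<rho> i) * d i))
      (at 0 within {0<..<\<epsilon>})"
    by (rule DERIV_subset) auto
  also have "at 0 within {0<..<\<epsilon>} = at_right 0"
    by (rule at_within_nhd[of _ "{..<\<epsilon>}"]) (use \<open>0 < \<epsilon>\<close> in auto)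
  finally show ?thesis .
qed

section \<open>The potential and its derivative\<close>

lemma Q_eq_0:
  assumes "\<forall>r\<in>{0..1}. \<kappa> r = 0" "r \<in> {0..1}"
  shows "Q \<kappa> r = 0"
proof -
  have "Q \<kappa> r = (LBINT \<tau>=1..ereal r. 0)"
    unfolding Q_def
    by (rule interval_integral_cong)
      (use assms in \<open>auto simp: einterval_iff one_ereal_def min_def max_def split: if_splits\<close>)
  then show ?thesis
    by simp
qed

lemma Q'_eq_0:
  assumes "1 < R" "continuous_on {0..<R} \<kappa>" "\<forall>r\<in>{0..1}. \<kappa> r = 0" "r \<in> {0..1}"
  shows "Q' R \<kappa> r = 0"
proof -
  have "Q' R \<kappa> r = (LBINT \<tau>=1..ereal r. \<kappa> \<tau>)"
    by (rule Q'_eq) (use assms in auto)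
  also have "\<dots> = (LBINT \<tau>=1..ereal r. 0)"
    by (rule interval_integral_cong)
      (use assms in \<open>auto simp: einterval_iff one_ereal_def min_def max_def split: if_splits\<close>)
  finally show ?thesis
    by simp
qed

lemma Q'_nonneg:
  assumes "1 < R" "continuous_on {0..<R} \<kappa>" "\<forall>r\<in>{0..1}. \<kappa> r = 0" "\<kappa> ` {0..<R} \<subseteq> {0..}"
    and "r \<in> {0..<R}"
  shows "0 \<le> Q' R \<kappa> r"
proof (cases "r \<le> 1")
  case True
  then show ?thesis
    using Q'_eq_0[OF assms(1-3)] assms(5) by simp
next
  case False
  have "Q' R \<kappa> r = (LBINT \<tau>=1..ereal r. \<kappa> \<tau>)"
    by (rule Q'_eq) (use assms in auto)
  also have "\<dots> = (LBINT \<tau>:{1<..<r}. \<kappa> \<tau>)"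
    using False by (simp add: one_ereal_def interval_lebesgue_integral_le_eq)
  also have "\<dots> \<ge> 0"
    unfolding set_lebesgue_integral_def
    by (rule integral_nonneg_AE) (use assms in \<open>auto simp: indicator_def image_subset_iff\<close>)
  finally show ?thesis .
qed

section \<open>Invariance of the admissible range\<close>

lemma mult_h_minus_nonpos:
  fixes h :: "real \<Rightarrow> real"
  assumes "mono h" "h 0 = 0"
  shows "s * h (- s) \<le> 0"
proof (cases "0 \<le> s")
  case True
  then have "h (- s) \<le> 0"
    using monoD[OF assms(1), of "- s" 0] assms(2) by simp
  then show ?thesis
    using True by (simp add: mult_nonneg_nonpos)
next
  case False
  then have "0 \<le> h (- s)"
    using monoD[OF assms(1), of 0 "- s"] assms(2) by simp
  then show ?thesis
    using False by (simp add: mult_nonpos_nonneg)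
qed

text \<open>Every flux is at most \<open>M R\<close> in absolute value, so the two bounds on \<open>t\<close> keep the change at a site
  below the distance from \<open>S\<close> to \<open>R\<close> and within the distance from \<open>1\<close> to \<open>0\<close>. This settles the
  upper bound, and nonnegativity where \<open>\<rho>\<^sub>i > 1\<close>. If \<open>\<rho>\<^sub>i \<le> 1\<close>, then \<open>Q'(\<rho>\<^sub>i) = 0\<close> is the least value
  of \<open>Q'\<close>, hence \<open>q\<close> is nonpositive and the flux nonnegative at site \<open>i - 1\<close>, while the loss at site
  \<open>i\<close> is at most \<open>t M \<rho>\<^sub>i / \<delta>x \<le> \<rho>\<^sub>i\<close>.\<close>

lemma rho_plus_in_range:
  assumes R: "1 < R" and \<kappa>: "continuous_on {0..<R} \<kappa>" "\<forall>r\<in>{0..1}. \<kappa> r = 0" "\<kappa> ` {0..<R} \<subseteq> {0..}"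
    and h: "mono h" "h 0 = 0" "\<And>s. \<bar>h s\<bar> \<le> M" and "0 < \<delta>x"
    and \<rho>: "\<And>i. \<rho> i \<in> {0..<R}" "\<And>i. \<rho> i \<le> S"
    and t: "0 \<le> t" "t / \<delta>x * (2 * M * R) \<le> 1" "t / \<delta>x * (2 * M * R) < R - S"
  shows "rho_plus R \<kappa> h \<delta>x \<rho> t i \<in> {0..<R}"
proof -
  define l where "l = t / \<delta>x"
  define G' where "G' = G R \<kappa> h \<delta>x \<rho>"
  have l: "0 \<le> l" "l * (2 * M * R) \<le> 1" "l * (2 * M * R) < R - S"
    using t \<open>0 < \<delta>x\<close> by (auto simp: l_def)
  have M: "0 \<le> M"
    using h(3)[of 0] by simp
  have G: "\<bar>G' j\<bar> \<le> M * \<rho> j" for j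
    using mult_left_mono[OF h(3), of "\<rho> j"] \<rho>(1)[of j]
    by (simp add: G'_def G_def abs_mult mult.commute)
  have GR: "\<bar>G' j\<bar> \<le> M * R" for j
    by (rule order_trans[OF G]) (use M \<rho>(1)[of j] in \<open>auto intro: mult_left_mono\<close>)
  have "\<bar>G' (i - 1) - G' i\<bar> \<le> 2 * M * R"
    using GR[of "i - 1"] GR[of i] by linarith
  then have change: "\<bar>l * (G' (i - 1) - G' i)\<bar> \<le> l * (2 * M * R)"
    using l(1) by (simp add: abs_mult mult_left_mono)
  have eq: "rho_plus R \<kappa> h \<delta>x \<rho> t i = \<rho> i + l * (G' (i - 1) - G' i)"
    by (simp add: rho_plus_def l_def G'_def)
  have "0 \<le> \<rho> i + l * (G' (i - 1) - G' i)"
  proof (cases "\<rho> i \<le> 1")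
    case True
    have "Q' R \<kappa> (\<rho> i) = 0"
      using Q'_eq_0[OF R \<kappa>(1,2)] True \<rho>(1)[of i] by simp
    moreover have "0 \<le> Q' R \<kappa> (\<rho> (i - 1))"
      by (rule Q'_nonneg[OF R \<kappa> \<rho>(1)])
    ultimately have "q R \<kappa> \<delta>x \<rho> (i - 1) \<le> 0"
      using \<open>0 < \<delta>x\<close> by (simp add: q_def divide_nonpos_pos)
    then have "0 \<le> h (- q R \<kappa> \<delta>x \<rho> (i - 1))"
      using monoD[OF h(1), of 0 "- q R \<kappa> \<delta>x \<rho> (i - 1)"] h(2) by simp
    then have incoming: "0 \<le> l * G' (i - 1)"
      using \<rho>(1)[of "i - 1"] l(1) by (simp add: G'_def G_def)
    have "l * M * 1 \<le> l * M * (2 * R)"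
      by (rule mult_left_mono) (use R l(1) M in auto)
    then have "l * M \<le> 1"
      using l(2) by (simp add: algebra_simps)
    have "l * G' i \<le> l * (M * \<rho> i)"
      by (rule mult_left_mono) (use G[of i] l(1) in auto)
    also have "\<dots> \<le> \<rho> i"
      using mult_right_mono[OF \<open>l * M \<le> 1\<close>, of "\<rho> i"] \<rho>(1)[of i] by (simp add: mult.assoc)
    finally show ?thesis
      using incoming by (simp add: right_diff_distrib)
  next
    case False
    then show ?thesis
      using change l(2) by linarith
  qed
  moreover have "\<rho> i + l * (G' (i - 1) - G' i) < R"
    using change l(3) \<rho>(2)[of i] by linarith
  ultimately show ?thesis
    by (simp add: eq)
qed

section \<open>Dissipation of the discrete energy\<close>

theorem proposition3:
  fixes R b \<delta>x :: real and \<kappa> h :: "real \<Rightarrow> real" and \<rho> :: "int \<Rightarrow> real"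
  assumes "R > 1" and "b > 0"
    and "C1_within {0..<R} \<kappa>" and "\<kappa> ` {0..<R} \<subseteq> {0..}"
    and "\<forall>r\<in>{0..1}. \<kappa> r = 0" and "\<forall>r\<in>{1<..<R}. \<kappa> r > 0"
    and "C1_within UNIV h" and "Linfty (deriv h)"
    and "h 0 = 0" and "\<forall>s. deriv h s > 0" and "range h = {-1<..<b}"
    and "\<delta>x > 0"
    and "\<forall>i. \<rho> i \<in> {0..<R}" and "(SUP i. \<rho> i) < R" and "\<rho> summable_on UNIV"
  shows "(\<exists>\<epsilon>>0. {0..\<epsilon>} \<subseteq> admissible_steps R \<kappa> h \<delta>x \<rho>)
    \<and> (\<forall>\<delta>t\<in>admissible_steps R \<kappa> h \<delta>x \<rho>.
          (\<lambda>i. Q \<kappa> (rho_plus R \<kappa> h \<delta>x \<rho> \<delta>t i)) summable_on UNIV)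
    \<and> (\<lambda>i. \<rho> i * q R \<kappa> \<delta>x \<rho> i * h (- q R \<kappa> \<delta>x \<rho> i)) summable_on UNIV
    \<and> (discrete_energy R \<kappa> h \<delta>x \<rho> has_real_derivative
          \<delta>x * (\<Sum>\<^sub>\<infinity>i\<in>UNIV. \<rho> i * q R \<kappa> \<delta>x \<rho> i * h (- q R \<kappa> \<delta>x \<rho> i))) (at_right 0)
    \<and> \<delta>x * (\<Sum>\<^sub>\<infinity>i\<in>UNIV. \<rho> i * q R \<kappa> \<delta>x \<rho> i * h (- q R \<kappa> \<delta>x \<rho> i)) \<le> 0"
proof -
  note R = \<open>R > 1\<close> and \<kappa>0 = \<open>\<forall>r\<in>{0..1}. \<kappa> r = 0\<close>
  have \<rho>: "\<rho> i \<in> {0..<R}" for i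
    using assms by blast
  have \<rho>0: "0 \<le> \<rho> i" for i
    using \<rho>[of i] by simp
  have \<kappa>: "continuous_on {0..<R} \<kappa>"
    using \<open>C1_within {0..<R} \<kappa>\<close> unfolding C1_within_def
    by (metis DERIV_continuous_on)
  have h_deriv: "(h has_real_derivative deriv h s) (at s)" for s
    using \<open>C1_within UNIV h\<close> unfolding C1_within_def by (metis DERIV_imp_deriv UNIV_I)
  have h_mono: "mono h"
  proof (rule monoI)
    show "h x \<le> h y" if "x \<le> y" for x y
      by (rule DERIV_nonneg_imp_nondecreasing[OF that])
        (use h_deriv \<open>\<forall>s. deriv h s > 0\<close> less_imp_le in blast)
  qed
  define M where "M = 1 + b"
  have h_bound: "\<bar>h s\<bar> \<le> M" for s
    using rangeI[of h s] \<open>range h = {-1<..<b}\<close> \<open>b > 0\<close> by (auto simp: M_def)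
  define S where "S = (SUP i. \<rho> i)"
  have "bdd_above (range \<rho>)"
    using \<rho> by (intro bdd_aboveI2[where M = R]) (auto intro: less_imp_le)
  then have S: "\<rho> i \<le> S" for i
    unfolding S_def by (intro cSUP_upper) auto
  have "S < R"
    using assms by (simp add: S_def)

  define g where "g = (\<lambda>i. G R \<kappa> h \<delta>x \<rho> i / \<delta>x)"
  define d where "d = (\<lambda>i. g (i - 1) - g i)"
  have rho_plus: "rho_plus R \<kappa> h \<delta>x \<rho> t i = \<rho> i + t * d i" for t i
    by (simp add: rho_plus_def d_def g_def diff_divide_distrib[symmetric])
  have "(\<lambda>i. norm (g i)) summable_on UNIV"
  proof (rule Infinite_Sum.abs_summable_on_comparison_test')
    show "(\<lambda>i. M / \<delta>x * \<rho> i) summable_on UNIV"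
      by (intro summable_on_cmult_right assms)
    show "norm (g i) \<le> M / \<delta>x * \<rho> i" for i
      using divide_right_mono[OF mult_left_mono[OF h_bound[of "- q R \<kappa> \<delta>x \<rho> i"] \<rho>0[of i]], of \<delta>x]
        \<open>\<delta>x > 0\<close> \<rho>0[of i]
      by (simp add: g_def G_def abs_mult mult.commute)
  qed
  then have g_sum: "g summable_on UNIV"
    by (rule summable_on_iff_abs_summable_on_real[THEN iffD2])
  have "bij_betw (\<lambda>i::int. i - 1) UNIV UNIV"
    by (rule bij_betw_byWitness[where f' = "\<lambda>i. i + 1"]) auto
  then have "(\<lambda>i. g (i - 1)) summable_on UNIV"
    using summable_on_reindex_bij_betw[of "\<lambda>i::int. i - 1" UNIV UNIV g] g_sum by simp
  then have d_sum: "d summable_on UNIV"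
    unfolding d_def using g_sum by (rule summable_on_diff)

  \<comment> \<open>The factor \<open>1/2\<close> makes the inequality with \<open>R - S\<close> strict even at \<open>t = \<epsilon>\<close>.\<close>
  define \<epsilon> where "\<epsilon> = \<delta>x * (min 1 (R - S) / 2) / (2 * M * R)"
  have "0 < M" "0 < R"
    using R \<open>b > 0\<close> by (auto simp: M_def)
  then have MR: "0 < 2 * M * R"
    by simp
  then have "\<epsilon> > 0"
    using \<open>\<delta>x > 0\<close> \<open>S < R\<close> by (simp add: \<epsilon>_def)
  have admissible: "rho_plus R \<kappa> h \<delta>x \<rho> t i \<in> {0..<R}" if "t \<in> {0..\<epsilon>}" for t i
  proof (rule rho_plus_in_range[OF R \<kappa> \<kappa>0 assms(4) h_mono \<open>h 0 = 0\<close> h_bound \<open>\<delta>x > 0\<close> \<rho> S])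
    have "t / \<delta>x * (2 * M * R) \<le> \<epsilon> / \<delta>x * (2 * M * R)"
      using that MR \<open>\<delta>x > 0\<close> by (intro mult_right_mono divide_right_mono) auto
    also have "\<dots> = min 1 (R - S) / 2"
      using \<open>0 < M\<close> \<open>0 < R\<close> \<open>\<delta>x > 0\<close> by (simp add: \<epsilon>_def)
    finally show "t / \<delta>x * (2 * M * R) \<le> 1" "t / \<delta>x * (2 * M * R) < R - S"
      using \<open>S < R\<close> by (simp_all add: min_def split: if_splits)
  qed (use that in auto)

  have Q_sum: "(\<lambda>i. Q \<kappa> (rho_plus R \<kappa> h \<delta>x \<rho> t i)) summable_on UNIV"
    if "t \<in> admissible_steps R \<kappa> h \<delta>x \<rho>" for t
  proof (rule finite_nonzero_values_imp_summable_on, rule finite_subset)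
    have range: "rho_plus R \<kappa> h \<delta>x \<rho> t i \<in> {0..<R}" for i
      using that by (simp add: admissible_steps_def)
    have "(\<lambda>i. rho_plus R \<kappa> h \<delta>x \<rho> t i) summable_on UNIV"
      unfolding rho_plus by (intro summable_on_add summable_on_cmult_right d_sum assms)
    then show "finite {i. 1 < rho_plus R \<kappa> h \<delta>x \<rho> t i}"
      by (rule finite_superlevel_set_of_summable) (use range in auto)
    show "{i \<in> UNIV. Q \<kappa> (rho_plus R \<kappa> h \<delta>x \<rho> t i) \<noteq> 0} \<subseteq> {i. 1 < rho_plus R \<kappa> h \<delta>x \<rho> t i}"
      using Q_eq_0[OF \<kappa>0] range by (force simp: not_less)
  qed

  define u where "u = (\<lambda>i. Q' R \<kappa> (\<rho> i))"
  have "finite {i. 1 < \<rho> i}"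
    by (rule finite_superlevel_set_of_summable) (use assms \<rho>0 in auto)
  moreover have "{i. u i \<noteq> 0} \<subseteq> {i. 1 < \<rho> i}"
    using Q'_eq_0[OF R \<kappa> \<kappa>0] \<rho>0 by (force simp: u_def not_less)
  ultimately have u_fin: "finite {i. u i \<noteq> 0}"
    by (rule rev_finite_subset)
  have terms: "(\<lambda>i. g i * (u (i + 1) - u i)) = (\<lambda>i. \<rho> i * q R \<kappa> \<delta>x \<rho> i * h (- q R \<kappa> \<delta>x \<rho> i))"
    by (simp add: fun_eq_iff g_def u_def G_def q_def mult_ac)
  note parts = summation_by_parts_finite_support[OF u_fin, of g, unfolded terms]

  have "((\<lambda>t. \<Sum>\<^sub>\<infinity>i. Q \<kappa> (\<rho> i + t * d i)) has_real_derivative (\<Sum>\<^sub>\<infinity>i. Q' R \<kappa> (\<rho> i) * d i)) (at_right 0)"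
  proof (rule infsum_has_derivative_of_dead_zone[OF assms(15) \<rho>0 d_sum \<open>\<epsilon> > 0\<close>])
    show "\<rho> i + t * d i \<in> {0..<R}" if "t \<in> {0..\<epsilon>}" for t i
      using admissible[OF that] by (simp add: rho_plus)
    show "(Q \<kappa> has_real_derivative Q' R \<kappa> r) (at r within {0..<R})" if "r \<in> {0..<R}" for r
      using Q_has_derivative[OF R \<kappa> that] Q'_eq[OF R \<kappa> that] by simp
  qed (use Q_eq_0[OF \<kappa>0] Q'_eq_0[OF R \<kappa> \<kappa>0] in auto)
  then have "((\<lambda>t. \<Sum>\<^sub>\<infinity>i. Q \<kappa> (\<rho> i + t * d i)) has_real_derivative
      (\<Sum>\<^sub>\<infinity>i. \<rho> i * q R \<kappa> \<delta>x \<rho> i * h (- q R \<kappa> \<delta>x \<rho> i))) (at_right 0)"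
    using parts(2) by (simp add: u_def d_def)
  moreover have "discrete_energy R \<kappa> h \<delta>x \<rho> = (\<lambda>t. \<delta>x * (\<Sum>\<^sub>\<infinity>i. Q \<kappa> (\<rho> i + t * d i)))"
    by (simp add: fun_eq_iff discrete_energy_def rho_plus)
  ultimately have energy: "(discrete_energy R \<kappa> h \<delta>x \<rho> has_real_derivative
      \<delta>x * (\<Sum>\<^sub>\<infinity>i. \<rho> i * q R \<kappa> \<delta>x \<rho> i * h (- q R \<kappa> \<delta>x \<rho> i))) (at_right 0)"
    by (simp add: DERIV_cmult)

  have "\<rho> i * q R \<kappa> \<delta>x \<rho> i * h (- q R \<kappa> \<delta>x \<rho> i) \<le> 0" for i
    using mult_left_mono[OF mult_h_minus_nonpos[OF h_mono \<open>h 0 = 0\<close>, of "q R \<kappa> \<delta>x \<rho> i"] \<rho>0[of i]]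
    by (simp add: mult.assoc)
  then have "(\<Sum>\<^sub>\<infinity>i. \<rho> i * q R \<kappa> \<delta>x \<rho> i * h (- q R \<kappa> \<delta>x \<rho> i)) \<le> 0"
    using infsum_mono[OF parts(1), of "\<lambda>_. 0"] by simp
  then have "\<delta>x * (\<Sum>\<^sub>\<infinity>i. \<rho> i * q R \<kappa> \<delta>x \<rho> i * h (- q R \<kappa> \<delta>x \<rho> i)) \<le> 0"
    using \<open>\<delta>x > 0\<close> by (simp add: mult_nonneg_nonpos)
  then show ?thesis
    using admissible \<open>\<epsilon> > 0\<close> Q_sum parts(1) energy
    by (auto simp: admissible_steps_def intro!: exI[of _ \<epsilon>])
qed

end
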